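(* Let $k\ge 1$ and $n>1$ be integers such that $r=nk+1$ is a prime belonging to $\mathcal P_k$, let $q$ be a power of a prime $p$ with $r\nmid q$, let $K$ be the subgroup of $\mathbb Z_r^*$ of order $k$, and assume $\langle q,K\rangle=\mathbb Z_r^*$. Then the following procedure correctly computes $C(n,k;q)$. Step 1. Choose $\omega\in\mathbb Z_r^*$ of order $k$ and form the multiset $\mathfrak S=\{S(u,v):(u,v)\in\mathcal S_k\}$. Step 2. Let $x_1,\dots,x_b$ be the distinct elements of $\mathfrak S$, with multiplicities $m_1,\dots,m_b$ in $\mathfrak S$, ordered so that $\{x_1,\dots,x_b\}\cap(-1)^k\langle\omega\rangle=\{x_1,\dots,x_a\}$. Let $\mathfrak M=\{m_1,\dots,m_b\}$ and $\mathfrak M_*=\{m_1,\dots,m_a\}$ (as multisets). Step 3. For $2\le\tau\le k$ put \[ a(\tau)=\frac 1\tau\cdot(\text{multiplicity of }\tau-1\text{ in }\mathfrak M),\qquad a_*(\tau)=\frac 1\tau\cdot(\text{multiplicity of }\tau-1\text{ in }\mathfrak M_* ), \] and put \[ a(1)=nk-1-\sum_{\tau=2}^k\tau a(\tau),\qquad a(0)=n^2-\sum_{\tau=1}^ka(\tau), \] \[ a_*(1)=k-1-\sum_{\tau=2}^k\tau a_*(\tau),\qquad a_*(0)=n-\sum_{\tau=1}^ka_*(\tau). \] Step 4. Output \[ n^2-\sum_{\substack{0\le\tau\le k\\ \tau\equiv 0\ (\mathrm{mod}\ p)}}\bigl(a(\tau)-a_*(\tau)\bigr)-\sum_{\substack{0\le\tau\le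 k\\ \tau\equiv k\ (\mathrm{mod}\ p)}}a_*(\tau). \] That is, the number output in Step 4 equals $C(n,k;q)$.
   Context: $\mathbb Z_m=\mathbb Z/m\mathbb Z$; $\mathbb Z_r^*$ is the multiplicative group of $\mathbb Z_r$. $\langle q,K\rangle$ is the subgroup of $\mathbb Z_r^*$ generated by the class of $q$ and $K$. Let $\mathcal S_k=\{(u,v)\in\mathbb Z_k^2:u\ne 0,\ v\ne 0,\ u\ne v\}$ and, for $\omega\in\mathbb Z_r^*$ of order $k$, \[ S:\mathcal S_k\to\mathbb Z_r^*\setminus\{-1\},\qquad S(u,v)=-\frac{1-\omega^v}{\omega^u-\omega^v}. \] $\mathcal P_k$ (the set of exceptional primes for $k$) is the set of primes $r>k+1$ with $r\equiv 1\pmod k$ for which $S$ is not one-to-one (this does not depend on the choice of $\omega$). The cyclotomic numbers are $t_{ij}=|(1+q^iK)\cap q^jK|$, $0\le i,j\le n-1$. Put $\delta_i=1$ if $k$ is even and $i=0$, or if $k$ is odd and $i=n/2$ (if $k$ is odd then $n$ is even); put $\delta_i=0$ otherwise. With $p=\operatorname{char}\mathbb F_q$, \[ C(n,k;q)=\bigl|\{(i,j):0\le i,j\le n-1,\ t_{ij}-k\delta_i\not\equiv 0\pmod p\}\bigr| . \] *)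

theory Defs
  imports "HOL-Number_Theory.Number_Theory" "HOL-Algebra.Algebra" "HOL-Library.Multiset"
begin

abbreviation Zring :: "nat \<Rightarrow> int ring" where
  "Zring r \<equiv> residue_ring (int r)"

abbreviation Zstar :: "nat \<Rightarrow> int monoid" where
  "Zstar r \<equiv> units_of (Zring r)"

(* Z_k is represented by the residues {0..<k}. Since S_val is only used with \<omega> of order k,
   the powers of \<omega> do not depend on this choice of representatives. *)
definition S_dom :: "nat \<Rightarrow> (nat \<times> nat) set" where
  "S_dom k = {(u, v). u < k \<and> v < k \<and> u \<noteq> 0 \<and> v \<noteq> 0 \<and> u \<noteq> v}"

definition S_val :: "nat \<Rightarrow> int \<Rightarrow> nat \<times> nat \<Rightarrow> int" where
  "S_val r \<omega> = (\<lambda>(u, v). let R = Zring r in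
     \<ominus>\<^bsub>R\<^esub> ((\<one>\<^bsub>R\<^esub> \<ominus>\<^bsub>R\<^esub> (\<omega> [^]\<^bsub>R\<^esub> v)) \<otimes>\<^bsub>R\<^esub>
        inv\<^bsub>R\<^esub> ((\<omega> [^]\<^bsub>R\<^esub> u) \<ominus>\<^bsub>R\<^esub> (\<omega> [^]\<^bsub>R\<^esub> v))))"

(* Injectivity of S does not depend on \<omega>: two elements of order k generate the same cyclic
   subgroup, so passing from one to the other multiplies u and v by a unit of Z_k. *)
definition exceptional_primes :: "nat \<Rightarrow> nat set" where
  "exceptional_primes k =
     {r. Factorial_Ring.prime r \<and> r > k + 1 \<and> [r = 1] (mod k) \<and>
         (\<exists>\<omega>\<in>carrier (Zstar r). group.ord (Zstar r) \<omega> = k \<and> \<not> inj_on (S_val r \<omega>) (S_dom k))}"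

definition cyc_coset :: "nat \<Rightarrow> int set \<Rightarrow> nat \<Rightarrow> nat \<Rightarrow> int set" where
  "cyc_coset r K q i =
     (let R = Zring r in ((int q mod int r) [^]\<^bsub>R\<^esub> i) <#\<^bsub>R\<^esub> K)"

definition cyclotomic_number :: "nat \<Rightarrow> int set \<Rightarrow> nat \<Rightarrow> nat \<Rightarrow> nat \<Rightarrow> nat" where
  "cyclotomic_number r K q i j =
     (let R = Zring r in card ((\<one>\<^bsub>R\<^esub> <+\<^bsub>R\<^esub> cyc_coset r K q i) \<inter> cyc_coset r K q j))"

definition cyc_delta :: "nat \<Rightarrow> nat \<Rightarrow> nat \<Rightarrow> nat" where
  "cyc_delta n k i = (if (even k \<and> i = 0) \<or> (odd k \<and> 2 * i = n) then 1 else 0)"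

(* C(n,k;q), where r = n * k + 1, K is the subgroup of order k and p is the characteristic of F_q *)
definition C_count :: "nat \<Rightarrow> nat \<Rightarrow> nat \<Rightarrow> nat \<Rightarrow> int set \<Rightarrow> nat" where
  "C_count n k q p K =
     card {(i, j). i < n \<and> j < n \<and>
       \<not> [int (cyclotomic_number (n * k + 1) K q i j) - int k * int (cyc_delta n k i) = 0] (mod int p)}"

definition S_mset :: "nat \<Rightarrow> nat \<Rightarrow> int \<Rightarrow> int multiset" where
  "S_mset r k \<omega> = image_mset (S_val r \<omega>) (mset_set (S_dom k))"

definition M_mset :: "nat \<Rightarrow> nat \<Rightarrow> int \<Rightarrow> nat multiset" where
  "M_mset r k \<omega> = image_mset (count (S_mset r k \<omega>)) (mset_set (set_mset (S_mset r k \<omega>)))"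

(* the coset (-1)^k <\<omega>> *)
definition special_coset :: "nat \<Rightarrow> nat \<Rightarrow> int \<Rightarrow> int set" where
  "special_coset r k \<omega> =
     (let R = Zring r in ((\<ominus>\<^bsub>R\<^esub> \<one>\<^bsub>R\<^esub>) [^]\<^bsub>R\<^esub> k) <#\<^bsub>R\<^esub> generate (Zstar r) {\<omega>})"

definition M_star_mset :: "nat \<Rightarrow> nat \<Rightarrow> int \<Rightarrow> nat multiset" where
  "M_star_mset r k \<omega> =
     image_mset (count (S_mset r k \<omega>)) (mset_set (set_mset (S_mset r k \<omega>) \<inter> special_coset r k \<omega>))"

(* The recipe shared by a and a_*: the multiset of multiplicities is M, the value at 1 is
   A minus a sum, and the value at 0 is B minus a sum. *)
definition step3 :: "nat \<Rightarrow> nat multiset \<Rightarrow> rat \<Rightarrow> rat \<Rightarrow> nat \<Rightarrow> rat" where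
  "step3 k M A B \<tau> =
     (let h = (\<lambda>\<tau>. of_nat (count M (\<tau> - 1)) / of_nat \<tau>);
          c = (\<lambda>\<tau>. if \<tau> = 1 then A - (\<Sum>\<sigma>=2..k. of_nat \<sigma> * h \<sigma>) else h \<tau>)
      in if \<tau> = 0 then B - (\<Sum>\<sigma>=1..k. c \<sigma>) else c \<tau>)"

definition a_coeff :: "nat \<Rightarrow> nat \<Rightarrow> int \<Rightarrow> nat \<Rightarrow> rat" where
  "a_coeff n k \<omega> =
     step3 k (M_mset (n * k + 1) k \<omega>) (of_nat n * of_nat k - 1) (of_nat n ^ 2)"

definition a_star_coeff :: "nat \<Rightarrow> nat \<Rightarrow> int \<Rightarrow> nat \<Rightarrow> rat" where
  "a_star_coeff n k \<omega> =
     step3 k (M_star_mset (n * k + 1) k \<omega>) (of_nat k - 1) (of_nat n)"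

definition procedure_output :: "nat \<Rightarrow> nat \<Rightarrow> nat \<Rightarrow> int \<Rightarrow> rat" where
  "procedure_output n k p \<omega> =
     of_nat n ^ 2
     - (\<Sum>\<tau>\<in>{\<tau>. \<tau> \<le> k \<and> [\<tau> = 0] (mod p)}. a_coeff n k \<omega> \<tau> - a_star_coeff n k \<omega> \<tau>)
     - (\<Sum>\<tau>\<in>{\<tau>. \<tau> \<le> k \<and> [\<tau> = k] (mod p)}. a_star_coeff n k \<omega> \<tau>)"

end

theory Submission
  imports Defs
begin

text \<open>
  Write \<open>R\<close> for the field of \<open>r = n k + 1\<close> elements. The powers \<open>q\<^sup>i\<close> with \<open>i < n\<close> represent the cosets of \<open>K\<close>,
  so every \<open>x\<close> with \<open>x \<noteq> 0\<close> and \<open>x \<noteq> -1\<close> lies in one cell: the pair \<open>(i, j)\<close> with \<open>x \<in> q\<^sup>i K\<close> and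
  \<open>1 + x \<in> q\<^sup>j K\<close>. The cell \<open>(i, j)\<close> has \<open>t\<^sub>i\<^sub>j\<close> elements, by translation.

  The heart of the matter is that the multiplicity of \<open>x\<close> in the multiset of the values \<open>S(u, v)\<close> is the
  number of other points in the cell of \<open>x\<close>. Since \<open>K\<close> is generated by \<open>\<omega>\<close>, any point of that cell has
  the form \<open>x \<omega>\<^sup>u\<close> with \<open>1 + x \<omega>\<^sup>u = (1 + x) \<omega>\<^sup>v\<close>, and for \<open>u \<noteq> v\<close> solving this equation for \<open>x\<close> gives
  \<open>x = S(u, v)\<close>; the point differs from \<open>x\<close> precisely when \<open>u\<close>, \<open>v\<close> and \<open>u - v\<close> are all nonzero
  (\<open>card_S_fibre\<close>). Hence the number of values
  with multiplicity \<open>\<tau> - 1 > 0\<close> is \<open>\<tau>\<close> times the number of cells of size \<open>\<tau>\<close>, which recovers the number of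
  cells of every size \<open>\<tau> \<ge> 2\<close>. The cells of size 1 and 0 are invisible in the multiset, but their
  numbers follow from the total number of points and the total number of cells
  (\<open>step3_counts_fibres\<close>).

  The correction \<open>k \<delta>\<^sub>i\<close> concerns a single row of cells, that of the coset of \<open>-1\<close> (\<open>idx_minus_one\<close>). The
  points of that row are the elements of \<open>(-1)\<^sup>k \<langle>\<omega>\<rangle>\<close> other than \<open>-1\<close> (\<open>special_coset_eq\<close>), so the same
  count restricted to this set gives the numbers \<open>a\<^sub>*(\<tau>)\<close> of cells of size \<open>\<tau>\<close> in that row. Counting cells
  of vanishing residue inside and outside the row gives the number that the procedure
  returns (\<open>count_nonvanishing_cells\<close>).
\<close>

section \<open>Counting fibres by their size\<close>

text \<open>
  The fibre over \<open>c\<close> of size \<open>\<sigma>\<close> contributes \<open>\<sigma>\<close> points, each with \<open>m\<close>-value \<open>\<sigma> - 1\<close>. For \<open>\<sigma> \<ge> 2\<close> this is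
  positive, so the multiset shows \<open>\<sigma>\<close> times the number of fibres of size \<open>\<sigma>\<close>. The numbers for 1 and 0 are
  then what is missing from the total number of points and from the total number of fibres. The lemma
  is used once for all cells and once for the row of cells of \<open>-1\<close>.
\<close>

lemma step3_counts_fibres:
  fixes P :: "'a set" and f :: "'a \<Rightarrow> 'b" and m :: "'a \<Rightarrow> nat"
  defines "t \<equiv> (\<lambda>c. card {x \<in> P. f x = c})"
  assumes fin: "finite P" "finite C" and fP: "f ` P \<subseteq> C"
    and m: "\<And>x. x \<in> P \<Longrightarrow> m x = t (f x) - 1"
    and bound: "\<And>c. c \<in> C \<Longrightarrow> t c \<le> k" and k: "k \<ge> 1" and \<tau>: "\<tau> \<le> k"
  shows "step3 k (image_mset m (mset_set {x \<in> P. m x > 0})) (of_nat (card P)) (of_nat (card C)) \<tau>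
    = of_nat (card {c \<in> C. t c = \<tau>})"
proof -
  define M where "M = image_mset m (mset_set {x \<in> P. m x > 0})"
  define N where "N = (\<lambda>\<sigma>. card {c \<in> C. t c = \<sigma>})"
  have points: "card {x \<in> P. t (f x) = \<sigma>} = \<sigma> * N \<sigma>" for \<sigma>
  proof -
    have "(\<Sum>c\<in>{c \<in> C. t c = \<sigma>}. card {x \<in> {x \<in> P. t (f x) = \<sigma>}. f x = c})
        = card {x \<in> P. t (f x) = \<sigma>}"
      using sum.group[of "{x \<in> P. t (f x) = \<sigma>}" "{c \<in> C. t c = \<sigma>}" f "\<lambda>_. 1::nat"] fin fP
      by auto
    moreover have "card {x \<in> {x \<in> P. t (f x) = \<sigma>}. f x = c} = \<sigma>"
      if "c \<in> {c \<in> C. t c = \<sigma>}" for c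
    proof -
      have "{x \<in> {x \<in> P. t (f x) = \<sigma>}. f x = c} = {x \<in> P. f x = c}" using that by auto
      with that show ?thesis by (simp add: t_def)
    qed
    ultimately show ?thesis by (simp add: N_def mult.commute)
  qed
  have count_M: "count M (\<sigma> - 1) = \<sigma> * N \<sigma>" if "\<sigma> \<ge> 2" for \<sigma>
  proof -
    have "count M (\<sigma> - 1) = card {x \<in> P. m x > 0 \<and> \<sigma> - 1 = m x}"
      unfolding M_def count_image_mset' using fin
      by (simp add: conj_assoc)
    also have "{x \<in> P. m x > 0 \<and> \<sigma> - 1 = m x} = {x \<in> P. t (f x) = \<sigma>}"
      using m that by auto
    finally show ?thesis by (simp add: points)
  qed
  have sumN: "(\<Sum>\<sigma>=0..k. N \<sigma>) = card C"
    using sum.group[of C "{0..k}" t "\<lambda>_. 1::nat"] fin bound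
    by (simp add: N_def image_subset_iff)
  have "(\<Sum>\<sigma>=0..k. \<sigma> * N \<sigma>) = card P"
    using sum.group[of P "{0..k}" "\<lambda>x. t (f x)" "\<lambda>_. 1::nat"] fin fP bound
    by (simp add: points[symmetric] image_subset_iff)
  then have sumP: "N 1 + (\<Sum>\<sigma>=2..k. \<sigma> * N \<sigma>) = card P"
    using k sum.atLeast_Suc_atMost[of 0 k "\<lambda>\<sigma>. \<sigma> * N \<sigma>"]
      sum.atLeast_Suc_atMost[of "Suc 0" k "\<lambda>\<sigma>. \<sigma> * N \<sigma>"]
    by (simp add: numeral_2_eq_2)
  define h :: "nat \<Rightarrow> rat" where "h = (\<lambda>\<sigma>. of_nat (count M (\<sigma> - 1)) / of_nat \<sigma>)"
  have h: "h \<sigma> = of_nat (N \<sigma>)" if "\<sigma> \<ge> 2" for \<sigma>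
    using that count_M[OF that] by (simp add: h_def del: One_nat_def)
  have hsum: "(\<Sum>\<sigma>=2..k. of_nat \<sigma> * h \<sigma>) = of_nat (\<Sum>\<sigma>=2..k. \<sigma> * N \<sigma>)"
    by (simp add: h)
  define c where "c = (\<lambda>\<tau>. if \<tau> = 1 then of_nat (card P) - (\<Sum>\<sigma>=2..k. of_nat \<sigma> * h \<sigma>) else h \<tau>)"
  have c: "c \<sigma> = of_nat (N \<sigma>)" if "\<sigma> \<ge> 1" for \<sigma>
    using that h[of \<sigma>] by (auto simp: c_def hsum sumP[symmetric])
  have "step3 k M (of_nat (card P)) (of_nat (card C)) \<tau> =
      (if \<tau> = 0 then of_nat (card C) - (\<Sum>\<sigma>=1..k. c \<sigma>) else c \<tau>)"
    unfolding step3_def Let_def c_def h_def by simp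
  also have "\<dots> = of_nat (N \<tau>)"
  proof -
    have "(\<Sum>\<sigma>=1..k. c \<sigma>) = of_nat (\<Sum>\<sigma>=1..k. N \<sigma>)" by (simp add: c)
    moreover have "card C = N 0 + (\<Sum>\<sigma>=1..k. N \<sigma>)"
      unfolding sumN[symmetric] by (simp add: sum.atLeast_Suc_atMost)
    ultimately show ?thesis by (simp add: c)
  qed
  finally show ?thesis by (simp add: M_def N_def)
qed

text \<open>
  In the row \<open>i0\<close> a cell is excluded when its size is congruent to \<open>k\<close>, elsewhere when its size is
  congruent to 0; \<open>a - a_star\<close> counts the cells outside the row.
\<close>

lemma count_nonvanishing_cells:
  fixes t :: "nat \<times> nat \<Rightarrow> nat" and a a_star :: "nat \<Rightarrow> rat"
  assumes i0: "i0 < n"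
    and bound: "\<And>i j. i < n \<Longrightarrow> j < n \<Longrightarrow> t (i, j) \<le> k"
    and a: "\<And>\<tau>. \<tau> \<le> k \<Longrightarrow> a \<tau> = of_nat (card {c \<in> {..<n} \<times> {..<n}. t c = \<tau>})"
    and a_star: "\<And>\<tau>. \<tau> \<le> k \<Longrightarrow> a_star \<tau> = of_nat (card {c \<in> {i0} \<times> {..<n}. t c = \<tau>})"
  shows "of_nat n ^ 2 - (\<Sum>\<tau> | \<tau> \<le> k \<and> [\<tau> = 0] (mod p). a \<tau> - a_star \<tau>)
      - (\<Sum>\<tau> | \<tau> \<le> k \<and> [\<tau> = k] (mod p). a_star \<tau>)
    = of_nat (card {(i, j). i < n \<and> j < n \<and>
        \<not> [int (t (i, j)) - int k * int (if i = i0 then 1 else 0) = 0] (mod int p)})"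
proof -
  let ?I = "{..<n} \<times> {..<n}" and ?row = "{i0} \<times> {..<n}"
  let ?rest = "({..<n} - {i0}) \<times> {..<n}"
  let ?bad = "{c \<in> ?rest. [t c = 0] (mod p)} \<union> {c \<in> ?row. [t c = k] (mod p)}"
  have group: "(\<Sum>\<tau> | \<tau> \<le> k \<and> Q \<tau>. card {c \<in> A. t c = \<tau>}) = card {c \<in> A. Q (t c)}"
    if A: "finite A" "A \<subseteq> ?I" for A Q
  proof -
    have "(\<Sum>\<tau> | \<tau> \<le> k \<and> Q \<tau>. card {c \<in> {c \<in> A. Q (t c)}. t c = \<tau>}) = card {c \<in> A. Q (t c)}"
      using sum.group[of "{c \<in> A. Q (t c)}" "{\<tau>. \<tau> \<le> k \<and> Q \<tau>}" t "\<lambda>_. 1 :: nat"] A bound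
      by (fastforce simp: image_subset_iff)
    moreover have "{c \<in> {c \<in> A. Q (t c)}. t c = \<tau>} = {c \<in> A. t c = \<tau>}" if "Q \<tau>" for \<tau>
      using that by auto
    ultimately show ?thesis by simp
  qed
  have diff: "a \<tau> - a_star \<tau> = of_nat (card {c \<in> ?rest. t c = \<tau>})" if "\<tau> \<le> k" for \<tau>
  proof -
    have "{c \<in> ?I. t c = \<tau>} = {c \<in> ?rest. t c = \<tau>} \<union> {c \<in> ?row. t c = \<tau>}" using i0 by auto
    then have "card {c \<in> ?I. t c = \<tau>} = card {c \<in> ?rest. t c = \<tau>} + card {c \<in> ?row. t c = \<tau>}"
      by (simp add: card_Un_disjoint disjoint_iff)
    then show ?thesis using that by (simp add: a a_star)
  qed
  have "(\<Sum>\<tau> | \<tau> \<le> k \<and> [\<tau> = 0] (mod p). a \<tau> - a_star \<tau>)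
      = of_nat (card {c \<in> ?rest. [t c = 0] (mod p)})"
    using group[of ?rest "\<lambda>\<tau>. [\<tau> = 0] (mod p)"] by (auto simp: diff simp flip: of_nat_sum)
  moreover have "(\<Sum>\<tau> | \<tau> \<le> k \<and> [\<tau> = k] (mod p). a_star \<tau>)
      = of_nat (card {c \<in> ?row. [t c = k] (mod p)})"
    using group[of ?row "\<lambda>\<tau>. [\<tau> = k] (mod p)"] i0 by (auto simp: a_star simp flip: of_nat_sum)
  moreover have "card ?bad = card {c \<in> ?rest. [t c = 0] (mod p)} + card {c \<in> ?row. [t c = k] (mod p)}"
    by (rule card_Un_disjoint) auto
  moreover have "{(i, j). i < n \<and> j < n \<and>
        \<not> [int (t (i, j)) - int k * int (if i = i0 then 1 else 0) = 0] (mod int p)} = ?I - ?bad"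
  proof -
    have "[int s - int k = 0] (mod int p) \<longleftrightarrow> [s = k] (mod p)" for s
      using cong_int_iff[of s k p] by (simp add: cong_diff_iff_cong_0)
    moreover have "[int s = 0] (mod int p) \<longleftrightarrow> [s = 0] (mod p)" for s
      using cong_int_iff[of s 0 p] by simp
    ultimately show ?thesis by (auto split: if_splits)
  qed
  moreover have "card (?I - ?bad) = n ^ 2 - card ?bad" and "card ?bad \<le> n ^ 2"
  proof -
    have sub: "?bad \<subseteq> ?I" using i0 by auto
    then show "card (?I - ?bad) = n ^ 2 - card ?bad"
      by (subst card_Diff_subset) (auto intro: finite_subset simp: power2_eq_square)
    show "card ?bad \<le> n ^ 2" using card_mono[OF _ sub] by (simp add: power2_eq_square)
  qed
  ultimately show ?thesis by (simp add: of_nat_diff)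
qed

section \<open>Cosets represented by powers\<close>

text \<open>
  The quotient by \<open>H\<close> is generated by the class of \<open>g\<close>, since the elements of \<open>H\<close> become trivial; it is
  therefore cyclic of order \<open>n\<close>.
\<close>

lemma (in comm_group) powers_represent_cosets:
  assumes fin: "finite (carrier G)" and H: "subgroup H G" and g: "g \<in> carrier G"
    and gen: "generate G (insert g H) = carrier G" and ord: "order G = n * card H"
  shows power_mem_iff: "g [^] (m::nat) \<in> H \<longleftrightarrow> n dvd m"
    and ex_coset: "x \<in> carrier G \<Longrightarrow> \<exists>i<n. x \<in> (g [^] i) <# H"
proof -
  interpret N: normal H G using H subgroup_imp_normal by blast
  interpret Q: group "G Mod H" by (rule N.factorgroup_is_group)
  let ?h = "\<lambda>a. H #> a"
  interpret hom: group_hom G "G Mod H" ?h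
    using N.r_coset_hom_Mod by unfold_locales
  have Hsub: "H \<subseteq> carrier G" by (rule N.subset)
  have finQ: "finite (carrier (G Mod H))"
    unfolding FactGroup_def using fin by (simp add: RCOSETS_def)
  have hg: "?h g \<in> carrier (G Mod H)" using g by simp
  have "?h ` H = {H}" using N.rcos_const[OF is_group] N.one_closed by blast
  then have "?h ` insert g H = {?h g, \<one>\<^bsub>G Mod H\<^esub>}" by simp
  then have "carrier (G Mod H) = generate (G Mod H) {?h g, \<one>\<^bsub>G Mod H\<^esub>}"
    using hom.generate_img[of "insert g H"] gen g Hsub by (auto simp: FactGroup_def RCOSETS_def)
  also have "\<dots> = generate (G Mod H) {?h g}"
  proof
    have "{?h g, \<one>\<^bsub>G Mod H\<^esub>} \<subseteq> generate (G Mod H) {?h g}"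
      using generate.one[of "G Mod H"] by (auto intro: generate.incl simp del: one_FactGroup)
    then show "generate (G Mod H) {?h g, \<one>\<^bsub>G Mod H\<^esub>} \<subseteq> generate (G Mod H) {?h g}"
      using Q.generate_subgroup_incl Q.generate_is_subgroup hg by simp
    show "generate (G Mod H) {?h g} \<subseteq> generate (G Mod H) {?h g, \<one>\<^bsub>G Mod H\<^esub>}"
      by (rule Q.mono_generate) simp
  qed
  finally have cyc: "carrier (G Mod H) = generate (G Mod H) {?h g}" .
  have "card (rcosets H) * card H = n * card H"
    using lagrange[OF H] ord by (rule trans)
  moreover have "card H > 0"
    using subgroup.one_closed[OF H] finite_subset[OF Hsub fin] card_gt_0_iff[of H] by force
  ultimately have "card (carrier (G Mod H)) = n" by (simp add: FactGroup_def)
  then have ordg: "Q.ord (?h g) = n"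
    using Q.generate_pow_card[OF hg] cyc by simp
  have "g [^] m \<in> H \<longleftrightarrow> ?h (g [^] m) = \<one>\<^bsub>G Mod H\<^esub>"
    using N.rcos_const[OF is_group] rcos_self[OF _ H, of "g [^] m"] g
    by (auto simp: FactGroup_def)
  also have "\<dots> \<longleftrightarrow> n dvd m"
    using Q.pow_eq_id[OF hg, of m] ordg N.FactGroup_pow[OF g, of m] by simp
  finally show "g [^] m \<in> H \<longleftrightarrow> n dvd m" .
  assume x: "x \<in> carrier G"
  then have "?h x \<in> carrier (G Mod H)" by simp
  also have "carrier (G Mod H) = {?h g [^]\<^bsub>G Mod H\<^esub> i | i. i \<in> (UNIV :: nat set)}"
    by (rule trans[OF cyc Q.generate_pow_on_finite_carrier[OF finQ hg]])
  finally have "?h x \<in> {?h g [^]\<^bsub>G Mod H\<^esub> i | i. i \<in> (UNIV :: nat set)}" .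
  then obtain i where "?h x = ?h g [^]\<^bsub>G Mod H\<^esub> i" "i \<in> {0..n - 1}"
    unfolding Q.ord_elems[OF finQ hg] ordg by auto
  moreover have "n > 0" using Q.ord_ge_1[OF finQ hg] ordg by simp
  ultimately have "H #> x = H #> (g [^] i)" "i < n"
    using N.FactGroup_pow[OF g, of i] by simp_all
  then show "\<exists>i<n. x \<in> (g [^] i) <# H"
    using rcos_self[OF x H] N.coset_eq g by auto
qed

lemma (in comm_group) ex1_coset:
  assumes fin: "finite (carrier G)" and H: "subgroup H G" and g: "g \<in> carrier G"
    and gen: "generate G (insert g H) = carrier G" and ord: "order G = n * card H"
    and x: "x \<in> carrier G"
  shows "\<exists>!i. i < n \<and> x \<in> (g [^] i) <# H"
proof -
  interpret H: subgroup H G by (rule H)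
  have le: "i = j" if ij: "i \<le> j" "j < n" and "x \<in> (g [^] i) <# H" "x \<in> (g [^] j) <# H"
    for i j :: nat
  proof -
    from that obtain a b where a: "a \<in> H" "x = g [^] i \<otimes> a" and b: "b \<in> H" "x = g [^] j \<otimes> b"
      by (auto simp: l_coset_def)
    have [simp]: "a \<in> carrier G" "b \<in> carrier G" using a b H.mem_carrier by auto
    have "g [^] j = g [^] i \<otimes> g [^] (j - i)" using ij g by (simp add: nat_pow_mult)
    then have "g [^] i \<otimes> a = g [^] i \<otimes> (g [^] (j - i) \<otimes> b)"
      using a b g by (simp add: m_assoc)
    then have "a = g [^] (j - i) \<otimes> b" using g by (subst (asm) l_cancel) auto
    then have "g [^] (j - i) = a \<otimes> inv b" using g by (simp add: m_assoc)
    then have "g [^] (j - i) \<in> H" using a b by simp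
    then have "n dvd j - i" using power_mem_iff[OF fin H g gen ord] by blast
    then show "i = j" using ij by (auto dest: dvd_imp_le)
  qed
  obtain i where "i < n" "x \<in> (g [^] i) <# H"
    using ex_coset[OF fin H g gen ord x] by blast
  then show ?thesis using le by (metis nat_le_linear)
qed

section \<open>Cosets and cells in a finite field\<close>

text \<open>
  The left-hand side is linear in \<open>x\<close> after multiplication by \<open>a - b\<close>, and the difference of the two sides
  becomes \<open>(1 - b) + x (a - b) = (1 + x a) - (1 + x) b\<close>.
\<close>

lemma (in field) S_eq_iff:
  assumes a: "a \<in> carrier R" and b: "b \<in> carrier R" and x: "x \<in> carrier R" and ab: "a \<noteq> b"
  shows "\<ominus> ((\<one> \<ominus> b) \<otimes> inv (a \<ominus> b)) = x \<longleftrightarrow> \<one> \<oplus> x \<otimes> a = (\<one> \<oplus> x) \<otimes> b"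
proof -
  define d where "d = a \<ominus> b"
  have d: "d \<in> carrier R" "d \<noteq> \<zero>" using a b ab by (auto simp: d_def)
  then have dU: "d \<in> Units R" by (simp add: field_Units)
  define p where "p = \<one> \<ominus> b"
  have p: "p \<in> carrier R" using b by (simp add: p_def)
  have "\<ominus> (p \<otimes> inv d) = x \<longleftrightarrow> \<ominus> (p \<otimes> inv d) \<otimes> d = x \<otimes> d"
    using p d dU x m_rcancel by simp
  also have "\<ominus> (p \<otimes> inv d) \<otimes> d = \<ominus> p"
    using p d dU by (simp add: l_minus m_assoc)
  also have "\<ominus> p = x \<otimes> d \<longleftrightarrow> p \<oplus> x \<otimes> d = \<zero>"
    using p x d add.inv_equality[of "x \<otimes> d" p] r_neg[of p] a_comm[of p "x \<otimes> d"] by auto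
  also have "p \<oplus> x \<otimes> d = (\<one> \<oplus> x \<otimes> a) \<ominus> (\<one> \<oplus> x) \<otimes> b"
    using a b x unfolding d_def p_def
    by (simp add: a_minus_def l_distr r_distr l_minus r_minus minus_add a_ac)
  also have "\<dots> = \<zero> \<longleftrightarrow> \<one> \<oplus> x \<otimes> a = (\<one> \<oplus> x) \<otimes> b"
    using a b x by simp
  finally show ?thesis by (simp add: p_def d_def)
qed

text \<open>
  The condition on \<open>-1\<close> says that the characteristic is odd. It gives \<open>-1\<close> the order 2, on which the
  position of \<open>-1\<close> among the cosets of \<open>K\<close> depends.
\<close>

locale cyclotomy = field R for R (structure) +
  fixes n k :: nat and K :: "'a set" and g \<omega> :: 'a
  assumes finite_carrier: "finite (carrier R)"
    and card_carrier: "card (carrier R) = n * k + 1"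
    and minus_one: "\<ominus> \<one> \<noteq> \<one>"
    and subgroup_K: "subgroup K (units_of R)" and card_K: "card K = k"
    and g_unit: "g \<in> Units R"
    and generates: "generate (units_of R) (insert g K) = carrier (units_of R)"
    and \<omega>_unit: "\<omega> \<in> Units R" and ord_\<omega>: "group.ord (units_of R) \<omega> = k"
begin

sublocale U: comm_group "units_of R" by (rule units_comm_group)

lemma pow_units_of [simp]: "x [^]\<^bsub>units_of R\<^esub> (m::nat) = x [^] m"
  by (simp add: nat_pow_def units_of_mult units_of_one)

lemma l_coset_units_of [simp]: "x <#\<^bsub>units_of R\<^esub> A = x <# A"
  by (simp add: l_coset_def units_of_mult)

lemmas units_of_simps [simp] = units_of_carrier units_of_mult units_of_one

lemma finite_units: "finite (Units R)"
  using finite_carrier by (simp add: field_Units)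

lemma card_units: "card (Units R) = n * k"
  using card_carrier finite_carrier by (simp add: field_Units)

lemma n_pos: "n > 0" and k_pos: "k > 0"
proof -
  have "card (Units R) \<noteq> 0" using finite_units Units_one_closed by (metis card_0_eq empty_iff)
  then show "n > 0" "k > 0" by (simp_all add: card_units)
qed

lemma K_units: "K \<subseteq> Units R"
  using subgroup.subset[OF subgroup_K] by simp

lemma K_carrier: "a \<in> K \<Longrightarrow> a \<in> carrier R"
  using K_units by auto

text \<open>
  A subgroup of order \<open>k\<close> consists of roots of \<open>X\<^sup>k - 1\<close>, which has at most \<open>k\<close> roots in a field. So there
  is only one such subgroup, and \<open>K\<close> is the group of powers of \<open>\<omega>\<close>.
\<close>

lemma K_roots: "K = {x \<in> carrier R. x [^] k = \<one>}"
  and generate_\<omega>: "generate (units_of R) {\<omega>} = K"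
proof -
  let ?Z = "{x \<in> carrier R. x [^] k = \<one>}"
  have eq: "H = ?Z" if H: "subgroup H (units_of R)" and card: "card H = k" for H
  proof (rule card_seteq)
    show "finite ?Z" using finite_carrier by simp
    show "card ?Z \<le> card H" using num_roots_le_deg[OF finite_carrier, of k] k_pos card by simp
    show "H \<subseteq> ?Z"
    proof
      fix x assume x: "x \<in> H"
      interpret H: group "units_of R\<lparr>carrier := H\<rparr>"
        using H U.subgroup_imp_group by blast
      have "x [^]\<^bsub>units_of R\<lparr>carrier := H\<rparr>\<^esub> k = \<one>\<^bsub>units_of R\<lparr>carrier := H\<rparr>\<^esub>"
        using H.pow_order_eq_1[of x] x card by (simp add: order_def)
      then have "x [^] k = \<one>" by (simp add: nat_pow_def)
      moreover have "x \<in> Units R" using x subgroup.subset[OF H] by auto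
      ultimately show "x \<in> ?Z" using Units_closed by simp
    qed
  qed
  show "K = ?Z" by (rule eq[OF subgroup_K card_K])
  moreover have "generate (units_of R) {\<omega>} = ?Z"
    using eq[of "generate (units_of R) {\<omega>}"] U.generate_is_subgroup[of "{\<omega>}"]
      U.generate_pow_card[of \<omega>] \<omega>_unit ord_\<omega> by simp
  ultimately show "generate (units_of R) {\<omega>} = K" by simp
qed

lemma K_powers: "a \<in> K \<longleftrightarrow> (\<exists>u<k. a = \<omega> [^] u)"
proof -
  have "K = {\<omega> [^] u | u. u \<in> {0..k - 1}}"
    using U.generate_pow_on_finite_carrier[of \<omega>] U.ord_elems[of \<omega>] \<omega>_unit ord_\<omega> finite_units
    by (simp add: generate_\<omega>)
  moreover have "u \<in> {0..k - 1} \<longleftrightarrow> u < k" for u using k_pos by auto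
  ultimately show ?thesis by auto
qed

lemma \<omega>_pow_inj: "\<omega> [^] u = \<omega> [^] v \<Longrightarrow> u < k \<Longrightarrow> v < k \<Longrightarrow> u = v"
  using U.ord_inj[of \<omega>] \<omega>_unit ord_\<omega> finite_units by (auto simp: inj_on_def)

lemma \<omega>_pow_unit [simp]: "\<omega> [^] (u::nat) \<in> Units R"
  using \<omega>_unit U.nat_pow_closed[of \<omega> u] by simp

lemma \<omega>_pow_carrier [simp]: "\<omega> [^] (u::nat) \<in> carrier R"
  using \<omega>_pow_unit by blast

abbreviation coset :: "nat \<Rightarrow> 'a set" where "coset i \<equiv> (g [^] i) <# K"

definition idx :: "'a \<Rightarrow> nat" where "idx x = (THE i. i < n \<and> x \<in> coset i)"

lemma ex1_idx: "x \<in> Units R \<Longrightarrow> \<exists>!i. i < n \<and> x \<in> coset i"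
  using U.ex1_coset[of K g n x] finite_units subgroup_K g_unit generates card_units card_K
  by (simp add: order_def)

lemma idx_less: "x \<in> Units R \<Longrightarrow> idx x < n"
  and mem_coset_idx: "x \<in> Units R \<Longrightarrow> x \<in> coset (idx x)"
  using theI'[OF ex1_idx, of x] by (simp_all add: idx_def)

lemma idx_eqI: "x \<in> Units R \<Longrightarrow> i < n \<Longrightarrow> x \<in> coset i \<Longrightarrow> idx x = i"
  using ex1_idx[of x] idx_less mem_coset_idx by blast

lemma g_pow_unit [simp]: "g [^] (i::nat) \<in> Units R"
  using g_unit U.nat_pow_closed[of g i] by simp

lemma coset_units: "coset i \<subseteq> Units R"
  using K_units by (auto simp: l_coset_def)

lemma mem_coset_iff: "i < n \<Longrightarrow> x \<in> coset i \<longleftrightarrow> x \<in> Units R \<and> idx x = i"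
  using coset_units idx_eqI mem_coset_idx by blast

lemma unit_coset:
  assumes x: "x \<in> Units R"
  shows "x <# K = {y \<in> Units R. idx y = idx x}"
proof -
  have "x <# K = coset (idx x)"
    using U.l_repr_independence[of x "g [^] idx x" K] mem_coset_idx[OF x] subgroup_K by simp
  then show ?thesis using mem_coset_iff[OF idx_less[OF x]] by auto
qed

lemma same_idx_iff:
  assumes x: "x \<in> Units R" and y: "y \<in> Units R"
  shows "idx y = idx x \<longleftrightarrow> (\<exists>u<k. y = x \<otimes> \<omega> [^] u)"
proof -
  have "idx y = idx x \<longleftrightarrow> y \<in> x <# K" using y by (simp add: unit_coset[OF x])
  also have "\<dots> \<longleftrightarrow> (\<exists>a\<in>K. y = x \<otimes> a)" by (auto simp: l_coset_def)
  also have "\<dots> \<longleftrightarrow> (\<exists>u<k. y = x \<otimes> \<omega> [^] u)"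
    unfolding Bex_def K_powers by auto
  finally show ?thesis .
qed

definition points :: "'a set" where "points = carrier R - {\<zero>, \<ominus> \<one>}"

definition cell :: "'a \<Rightarrow> nat \<times> nat" where "cell x = (idx x, idx (\<one> \<oplus> x))"

text \<open>
  The map \<open>S_val\<close> over an arbitrary field.
\<close>

definition S :: "nat \<times> nat \<Rightarrow> 'a" where
  "S = (\<lambda>(u, v). \<ominus> ((\<one> \<ominus> \<omega> [^] v) \<otimes> inv (\<omega> [^] u \<ominus> \<omega> [^] v)))"

lemma finite_points: "finite points"
  using finite_carrier by (simp add: points_def)

lemma minus_one_unit: "\<ominus> \<one> \<in> Units R"
  by (rule Units_minus_one_closed)

lemma one_plus_eq_zero_iff:
  assumes x: "x \<in> carrier R"
  shows "\<one> \<oplus> x = \<zero> \<longleftrightarrow> x = \<ominus> \<one>"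
proof
  assume "\<one> \<oplus> x = \<zero>"
  then show "x = \<ominus> \<one>" using x minus_equality[of x \<one>] a_comm[of x \<one>] by simp
qed (simp add: r_neg)

lemma points_iff: "x \<in> points \<longleftrightarrow> x \<in> Units R \<and> \<one> \<oplus> x \<in> Units R"
proof (cases "x \<in> carrier R")
  case True
  then show ?thesis using one_plus_eq_zero_iff[OF True] by (auto simp: points_def field_Units)
next
  case False
  then show ?thesis using Units_closed by (auto simp: points_def)
qed

lemma card_points: "card points = n * k - 1"
proof -
  have "\<ominus> \<one> \<noteq> \<zero>" using minus_one_unit by (simp add: field_Units)
  then have "\<zero> \<noteq> \<ominus> \<one>" by (rule not_sym)
  then have "card {\<zero>, \<ominus> \<one>} = 2" by simp
  moreover have "{\<zero>, \<ominus> \<one>} \<subseteq> carrier R" by simp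
  ultimately show ?thesis
    using card_Diff_subset[of "{\<zero>, \<ominus> \<one>}" "carrier R"] card_carrier by (simp add: points_def)
qed

lemma cell_in: "cell ` points \<subseteq> {..<n} \<times> {..<n}"
  using idx_less by (auto simp: cell_def points_iff)

lemma S_eq_iff_powers:
  assumes uv: "u < k" "v < k" "u \<noteq> v" and x: "x \<in> carrier R"
  shows "S (u, v) = x \<longleftrightarrow> \<one> \<oplus> x \<otimes> \<omega> [^] u = (\<one> \<oplus> x) \<otimes> \<omega> [^] v"
  using S_eq_iff[of "\<omega> [^] u" "\<omega> [^] v" x] \<omega>_pow_inj uv x by (auto simp: S_def)

lemma \<omega>_pow_eq_one: "\<omega> [^] u = \<one> \<Longrightarrow> u < k \<Longrightarrow> u = 0"
  using \<omega>_pow_inj[of u 0] k_pos by simp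

text \<open>
  The defining equation \<open>1 + x \<omega>\<^sup>u = (1 + x) \<omega>\<^sup>v\<close> would force \<open>\<omega>\<^sup>v = 1\<close> at \<open>x = 0\<close> and \<open>\<omega>\<^sup>u = 1\<close> at \<open>x = -1\<close>.
\<close>

lemma S_in_points:
  assumes "(u, v) \<in> S_dom k"
  shows "S (u, v) \<in> points"
proof -
  have uv: "u < k" "v < k" "u \<noteq> v" "u \<noteq> 0" "v \<noteq> 0" using assms by (auto simp: S_dom_def)
  have ne: "\<omega> [^] u \<ominus> \<omega> [^] v \<noteq> \<zero>" using \<omega>_pow_inj uv by auto
  then have "\<omega> [^] u \<ominus> \<omega> [^] v \<in> Units R" by (simp add: field_Units)
  then have closed: "S (u, v) \<in> carrier R" by (simp add: S_def)
  have eq: "\<one> \<oplus> S (u, v) \<otimes> \<omega> [^] u = (\<one> \<oplus> S (u, v)) \<otimes> \<omega> [^] v"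
    using S_eq_iff_powers[OF uv(1-3) closed] by simp
  have "S (u, v) \<noteq> \<zero>"
  proof
    assume "S (u, v) = \<zero>"
    then have "\<omega> [^] v = \<one>" using eq by simp
    then show False using \<omega>_pow_eq_one uv by blast
  qed
  moreover have "S (u, v) \<noteq> \<ominus> \<one>"
  proof
    assume "S (u, v) = \<ominus> \<one>"
    then have "\<one> \<oplus> \<ominus> (\<omega> [^] u) = \<zero>" using eq by (simp add: l_minus r_neg)
    then have "\<omega> [^] u = \<one>" using one_plus_eq_zero_iff[of "\<ominus> (\<omega> [^] u)"]
      by (metis \<omega>_pow_carrier a_inv_closed minus_minus one_closed)
    then show False using \<omega>_pow_eq_one uv by blast
  qed
  ultimately show ?thesis using closed by (simp add: points_def)
qed

text \<open>
  The pairs \<open>(u, v)\<close> over \<open>x\<close> correspond to the other points \<open>y = x \<omega>\<^sup>u\<close> of the cell of \<open>x\<close>, where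
  \<open>1 + y = (1 + x) \<omega>\<^sup>v\<close>. The three conditions defining \<open>S_dom\<close> all express \<open>y \<noteq> x\<close>: each of \<open>u = 0\<close>,
  \<open>v = 0\<close> and \<open>u = v\<close> leads to \<open>y = x\<close>.
\<close>

lemma card_S_fibre:
  assumes x: "x \<in> points"
  shows "card {s \<in> S_dom k. S s = x} = card {y \<in> points. cell y = cell x} - 1"
proof -
  have xU: "x \<in> Units R" "\<one> \<oplus> x \<in> Units R" using x by (auto simp: points_iff)
  have xc [simp]: "x \<in> carrier R" "\<one> \<oplus> x \<in> carrier R" using xU Units_closed by auto
  have nz: "x \<noteq> \<zero>" "\<one> \<oplus> x \<noteq> \<zero>" using xU by (auto simp: field_Units)
  let ?h = "\<lambda>(u, v :: nat). x \<otimes> \<omega> [^] (u :: nat)"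
  let ?D = "{s \<in> S_dom k. S s = x}" and ?Y = "{y \<in> points. cell y = cell x} - {x}"
  have rel: "\<one> \<oplus> x \<otimes> \<omega> [^] u = (\<one> \<oplus> x) \<otimes> \<omega> [^] v" if "(u, v) \<in> ?D" for u v
    using that S_eq_iff_powers[of u v x] by (auto simp: S_dom_def)
  have "bij_betw ?h ?D ?Y"
    unfolding bij_betw_def
  proof (intro conjI inj_onI subset_antisym subsetI)
    fix s s' assume s: "s \<in> ?D" "s' \<in> ?D" "?h s = ?h s'"
    obtain u v u' v' where [simp]: "s = (u, v)" "s' = (u', v')" by (cases s, cases s') auto
    have less: "u < k" "v < k" "u' < k" "v' < k" using s by (auto simp: S_dom_def)
    have eq: "x \<otimes> \<omega> [^] u = x \<otimes> \<omega> [^] u'" using s by simp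
    then have "\<omega> [^] u = \<omega> [^] u'" using nz(1) m_lcancel by simp
    moreover have "(\<one> \<oplus> x) \<otimes> \<omega> [^] v = (\<one> \<oplus> x) \<otimes> \<omega> [^] v'"
      using rel[of u v] rel[of u' v'] s(1,2) eq by simp
    then have "\<omega> [^] v = \<omega> [^] v'" using nz(2) m_lcancel by simp
    ultimately show "s = s'" using \<omega>_pow_inj less by simp
  next
    fix y assume "y \<in> ?h ` ?D"
    then obtain u v where uv: "(u, v) \<in> ?D" and y: "y = x \<otimes> \<omega> [^] u" by auto
    have less: "u < k" "v < k" "u \<noteq> 0" using uv by (auto simp: S_dom_def)
    have y1: "\<one> \<oplus> y = (\<one> \<oplus> x) \<otimes> \<omega> [^] v" using rel[OF uv] y by simp
    have yU: "y \<in> Units R" "\<one> \<oplus> y \<in> Units R" using xU unfolding y1 by (simp_all add: y)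
    have "y \<noteq> x"
    proof
      assume "y = x"
      then have "x \<otimes> \<omega> [^] u = x \<otimes> \<one>" using y by simp
      then have "\<omega> [^] u = \<one>" using nz(1) m_lcancel[of x "\<omega> [^] u" \<one>] by simp
      then show False using \<omega>_pow_eq_one less by blast
    qed
    moreover have "idx y = idx x" using same_idx_iff[OF xU(1) yU(1)] y less by blast
    moreover have "idx (\<one> \<oplus> y) = idx (\<one> \<oplus> x)" using same_idx_iff[OF xU(2) yU(2)] y1 less by blast
    ultimately show "y \<in> ?Y" using yU by (simp add: points_iff cell_def)
  next
    fix y assume "y \<in> ?Y"
    then have y: "y \<in> Units R" "\<one> \<oplus> y \<in> Units R" "idx y = idx x"
      "idx (\<one> \<oplus> y) = idx (\<one> \<oplus> x)" "y \<noteq> x"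
      by (auto simp: points_iff cell_def)
    have yc [simp]: "y \<in> carrier R" using y Units_closed by blast
    obtain u where u: "u < k" "y = x \<otimes> \<omega> [^] u" using same_idx_iff[OF xU(1) y(1)] y(3) by blast
    obtain v where v: "v < k" "\<one> \<oplus> y = (\<one> \<oplus> x) \<otimes> \<omega> [^] v"
      using same_idx_iff[OF xU(2) y(2)] y(4) by blast
    have "u \<noteq> 0" using u y(5) by (auto intro: gr0I)
    moreover have "v \<noteq> 0"
    proof
      assume "v = 0"
      then have "\<one> \<oplus> y = \<one> \<oplus> x" using v by simp
      then show False using y(5) by simp
    qed
    moreover have "u \<noteq> v"
    proof
      assume "u = v"
      then have "\<one> \<oplus> x \<otimes> \<omega> [^] u = \<omega> [^] u \<oplus> x \<otimes> \<omega> [^] u" using u v by (simp add: l_distr)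
      then have "\<omega> [^] u = \<one>" by simp
      then show False using \<omega>_pow_eq_one u \<open>u \<noteq> 0\<close> by blast
    qed
    ultimately have "(u, v) \<in> ?D"
      using u v S_eq_iff_powers[of u v x] by (auto simp: S_dom_def)
    then show "y \<in> ?h ` ?D" using u by (intro image_eqI[of _ _ "(u, v)"]) auto
  qed
  then have "card ?D = card ?Y" by (rule bij_betw_same_card)
  also have "\<dots> = card {y \<in> points. cell y = cell x} - 1"
    using x by (simp add: card_Diff_singleton)
  finally show ?thesis .
qed

lemma card_coset: "card (coset i) \<le> k"
proof -
  have "coset i = (\<lambda>a. g [^] i \<otimes> a) ` K" by (auto simp: l_coset_def)
  then show ?thesis using card_image_le[of K "\<lambda>a. g [^] i \<otimes> a"] finite_subset[OF K_units finite_units]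
    by (simp add: card_K)
qed

text \<open>
  Translation by 1 carries the points of the cell to the intersection.
\<close>

lemma card_cell:
  assumes ij: "i < n" "j < n"
  shows "card ((\<one> <+ coset i) \<inter> coset j) = card {x \<in> points. cell x = (i, j)}"
proof -
  have "(\<one> <+ coset i) \<inter> coset j = (\<lambda>x. \<one> \<oplus> x) ` {x \<in> points. cell x = (i, j)}"
    using ij by (auto simp: a_l_coset_def' mem_coset_iff points_iff cell_def)
  moreover have "inj_on (\<lambda>x. \<one> \<oplus> x) {x \<in> points. cell x = (i, j)}"
    by (auto simp: inj_on_def points_def)
  ultimately show ?thesis by (simp add: card_image)
qed

lemma card_cell_le:
  assumes ij: "i < n" "j < n"
  shows "card {x \<in> points. cell x = (i, j)} \<le> k"
proof -
  have "{x \<in> points. cell x = (i, j)} \<subseteq> coset i"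
    using ij by (auto simp: mem_coset_iff points_iff cell_def)
  then have "card {x \<in> points. cell x = (i, j)} \<le> card (coset i)"
    using finite_subset[OF coset_units finite_units] by (rule card_mono[rotated])
  then show ?thesis using card_coset[of i] by simp
qed

text \<open>
  This identifies the row with \<open>\<delta>\<^sub>i = 1\<close>. Since \<open>K\<close> consists of all \<open>k\<close>-th roots of unity, \<open>-1\<close> lies in
  \<open>K\<close> exactly when \<open>k\<close> is even. If \<open>k\<close> is odd, then \<open>-1 \<in> g\<^sup>i K\<close> gives \<open>g\<^sup>2\<^sup>i \<in> K\<close>, so \<open>n\<close> divides \<open>2 i\<close>; with \<open>0 < i < n\<close> this
  leaves \<open>2 i = n\<close>.
\<close>

lemma idx_minus_one:
  assumes i: "i < n"
  shows "(even k \<and> i = 0) \<or> (odd k \<and> 2 * i = n) \<longleftrightarrow> i = idx (\<ominus> \<one>)"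
proof -
  have coset0: "coset 0 = K" using K_carrier by (force simp: l_coset_def)
  have pow: "(\<ominus> \<one>) [^] k = (if even k then \<one> else \<ominus> \<one>)"
    by (induction k) (auto simp: l_minus)
  have inK: "\<ominus> \<one> \<in> K \<longleftrightarrow> even k" using minus_one pow by (simp add: K_roots)
  have idx0: "idx (\<ominus> \<one>) = 0 \<longleftrightarrow> even k"
    using mem_coset_iff[OF n_pos, of "\<ominus> \<one>"] minus_one_unit inK unfolding coset0 by simp
  have "2 * idx (\<ominus> \<one>) = n" if "odd k"
  proof -
    let ?i = "idx (\<ominus> \<one>)"
    obtain a where a: "a \<in> K" "\<ominus> \<one> = g [^] ?i \<otimes> a"
      using mem_coset_idx[OF minus_one_unit] by (auto simp: l_coset_def)
    have aU: "a \<in> Units R" using a K_units by blast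
    have "g [^] ?i \<otimes> a \<otimes> (g [^] ?i \<otimes> a) = \<one>" by (simp add: a(2)[symmetric] l_minus)
    moreover have "g [^] (2 * ?i) = g [^] ?i \<otimes> g [^] ?i"
      using nat_pow_mult[of g ?i ?i] g_unit by (simp add: mult_2 Units_closed)
    ultimately have "g [^] (2 * ?i) \<otimes> (a \<otimes> a) = \<one>"
      using aU by (simp add: m_ac Units_closed)
    then have "g [^] (2 * ?i) = inv (a \<otimes> a)"
      using aU U.inv_equality[of "g [^] (2 * ?i)" "a \<otimes> a"] by (simp add: units_of_inv)
    moreover have "inv (a \<otimes> a) \<in> K"
      using a aU subgroup.m_inv_closed[OF subgroup_K, of "a \<otimes> a"] subgroup.m_closed[OF subgroup_K, of a a]
      by (simp add: units_of_inv)
    ultimately have "n dvd 2 * ?i"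
      using U.power_mem_iff[of K g n "2 * ?i"] finite_units subgroup_K g_unit generates card_units card_K
      by (simp add: order_def)
    then obtain c where c: "2 * ?i = n * c" by blast
    have "n * c < n * 2" using idx_less[OF minus_one_unit] c by linarith
    then have "c = 0 \<or> c = 1" by (cases c) auto
    then show ?thesis using c idx0 that by auto
  qed
  then show ?thesis using idx0 by auto
qed

text \<open>
  The factor \<open>(-1)\<^sup>k\<close> is a uniform way of writing the coset of \<open>-1\<close>: for even \<open>k\<close> it is \<open>1\<close>, but then
  \<open>-1\<close> itself lies in \<open>K\<close>.
\<close>

lemma special_coset_eq:
  "((\<ominus> \<one>) [^] k) <# generate (units_of R) {\<omega>} = {y \<in> Units R. idx y = idx (\<ominus> \<one>)}"
proof -
  have pow: "(\<ominus> \<one>) [^] k = (if even k then \<one> else \<ominus> \<one>)"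
    by (induction k) (auto simp: l_minus)
  have "\<one> \<in> coset 0" using subgroup.one_closed[OF subgroup_K] by (auto simp: l_coset_def intro!: bexI[of _ \<one>])
  then have "idx \<one> = 0" using idx_eqI n_pos by simp
  then show ?thesis
    using unit_coset[of \<one>] unit_coset[OF minus_one_unit] idx_minus_one[OF n_pos] n_pos
    by (simp add: generate_\<omega> pow)
qed

text \<open>
  The coset of \<open>-1\<close> loses \<open>-1\<close> itself, since \<open>1 + x\<close> must be a unit.
\<close>

lemma card_special_points: "card {x \<in> points. idx x = idx (\<ominus> \<one>)} = k - 1"
proof -
  have "{x \<in> points. idx x = idx (\<ominus> \<one>)} = ((\<ominus> \<one>) <# K) - {\<ominus> \<one>}"
    unfolding unit_coset[OF minus_one_unit] by (auto simp: points_def field_Units)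
  moreover have "\<ominus> \<one> \<in> (\<ominus> \<one>) <# K" using unit_coset[OF minus_one_unit] minus_one_unit by simp
  moreover have "card ((\<ominus> \<one>) <# K) = k"
  proof -
    have "(\<ominus> \<one>) <# K = (\<lambda>a. \<ominus> \<one> \<otimes> a) ` K" by (auto simp: l_coset_def)
    moreover have "inj_on (\<lambda>a. \<ominus> \<one> \<otimes> a) K"
    proof (rule inj_onI)
      fix x y assume "x \<in> K" "y \<in> K" "\<ominus> \<one> \<otimes> x = \<ominus> \<one> \<otimes> y"
      then show "x = y"
        using U.l_cancel[of "\<ominus> \<one>" x y] minus_one_unit subsetD[OF K_units] by simp
    qed
    ultimately show ?thesis by (simp add: card_image card_K)
  qed
  ultimately show ?thesis by (simp add: card_Diff_singleton)
qed

section \<open>The multiset of values and the cells of each size\<close>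

definition S_multiset :: "'a multiset" where
  "S_multiset = image_mset S (mset_set (S_dom k))"

lemma finite_S_dom: "finite (S_dom k)"
  by (rule finite_subset[of _ "{..<k} \<times> {..<k}"]) (auto simp: S_dom_def)

lemma count_S_multiset:
  assumes "x \<in> points"
  shows "count S_multiset x = card {y \<in> points. cell y = cell x} - 1"
  using card_S_fibre[OF assms] finite_S_dom
  by (simp add: S_multiset_def count_image_mset' eq_commute)

lemma set_S_multiset: "set_mset S_multiset = {x \<in> points. count S_multiset x > 0}"
proof -
  have "set_mset S_multiset \<subseteq> points"
    using S_in_points finite_S_dom by (auto simp: S_multiset_def)
  then show ?thesis by auto
qed

lemma step3_all_cells:
  assumes "\<tau> \<le> k"
  shows "step3 k (image_mset (count S_multiset) (mset_set (set_mset S_multiset)))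
      (of_nat n * of_nat k - 1) (of_nat n ^ 2) \<tau>
    = of_nat (card {c \<in> {..<n} \<times> {..<n}. card {x \<in> points. cell x = c} = \<tau>})"
proof -
  have "of_nat (card points) = (of_nat n * of_nat k - 1 :: rat)"
    using n_pos k_pos by (simp add: card_points of_nat_diff)
  moreover have "of_nat (card ({..<n} \<times> {..<n})) = (of_nat n ^ 2 :: rat)"
    by (simp add: power2_eq_square)
  moreover have "step3 k (image_mset (count S_multiset) (mset_set {x \<in> points. count S_multiset x > 0}))
      (of_nat (card points)) (of_nat (card ({..<n} \<times> {..<n}))) \<tau>
    = of_nat (card {c \<in> {..<n} \<times> {..<n}. card {x \<in> points. cell x = c} = \<tau>})"
    by (rule step3_counts_fibres)
      (use finite_points cell_in count_S_multiset card_cell_le k_pos assms in auto)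
  ultimately show ?thesis by (simp only: flip: set_S_multiset)
qed

text \<open>
  A cell in the row of \<open>-1\<close> lies entirely in the coset of \<open>-1\<close>. The multiplicities counted in the full
  multiset are therefore already those of the restricted fibration, as \<open>step3_counts_fibres\<close> requires.
\<close>

lemma step3_special_cells:
  assumes "\<tau> \<le> k"
  defines "i0 \<equiv> idx (\<ominus> \<one>)"
  shows "step3 k (image_mset (count S_multiset) (mset_set (set_mset S_multiset \<inter>
        (((\<ominus> \<one>) [^] k) <# generate (units_of R) {\<omega>})))) (of_nat k - 1) (of_nat n) \<tau>
    = of_nat (card {c \<in> {i0} \<times> {..<n}. card {x \<in> points. cell x = c} = \<tau>})"
proof -
  let ?P = "{x \<in> points. idx x = i0}"
  have fibre: "{x \<in> ?P. cell x = c} = {x \<in> points. cell x = c}" if "c \<in> {i0} \<times> {..<n}" for c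
    using that by (auto simp: cell_def)
  have in_row: "cell x \<in> {i0} \<times> {..<n}" if "x \<in> ?P" for x
    using that idx_less by (auto simp: cell_def points_iff)
  have i0: "i0 < n" unfolding i0_def by (rule idx_less[OF minus_one_unit])
  have "step3 k (image_mset (count S_multiset) (mset_set {x \<in> ?P. count S_multiset x > 0}))
      (of_nat (card ?P)) (of_nat (card ({i0} \<times> {..<n}))) \<tau>
    = of_nat (card {c \<in> {i0} \<times> {..<n}. card {x \<in> ?P. cell x = c} = \<tau>})"
  proof (rule step3_counts_fibres)
    show "finite ?P" using finite_points by simp
    show "cell ` ?P \<subseteq> {i0} \<times> {..<n}" using in_row by blast
    show "count S_multiset x = card {y \<in> ?P. cell y = cell x} - 1" if "x \<in> ?P" for x
      using that fibre[OF in_row[OF that]] count_S_multiset by simp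
    show "card {x \<in> ?P. cell x = c} \<le> k" if "c \<in> {i0} \<times> {..<n}" for c
      using that fibre[OF that] card_cell_le i0 by auto
  qed (use k_pos assms in auto)
  moreover have "{c \<in> {i0} \<times> {..<n}. card {x \<in> ?P. cell x = c} = \<tau>}
      = {c \<in> {i0} \<times> {..<n}. card {x \<in> points. cell x = c} = \<tau>}"
    using fibre by (intro Collect_cong) auto
  moreover have "set_mset S_multiset \<inter> (((\<ominus> \<one>) [^] k) <# generate (units_of R) {\<omega>})
      = {x \<in> ?P. count S_multiset x > 0}"
    unfolding special_coset_eq set_S_multiset i0_def by (auto simp: points_iff)
  moreover have "of_nat (card ?P) = (of_nat k - 1 :: rat)"
    unfolding i0_def card_special_points using k_pos by (simp add: of_nat_diff)
  moreover have "card ({i0} \<times> {..<n}) = n" by simp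
  ultimately show ?thesis by (simp only:)
qed

end

section \<open>The procedure over the prime field\<close>

theorem mainTheorem3:
  fixes n k r p e q :: nat and K :: "int set" and \<omega> :: int
  assumes "k \<ge> 1" and "n > 1"
    and "r = n * k + 1" and "Factorial_Ring.prime r" and "r \<in> exceptional_primes k"
    and "Factorial_Ring.prime p" and "e \<ge> 1" and "q = p ^ e" and "\<not> r dvd q"
    and "subgroup K (Zstar r)" and "card K = k"
    and "generate (Zstar r) (insert (int q mod int r) K) = carrier (Zstar r)"
    and "\<omega> \<in> carrier (Zstar r)" and "group.ord (Zstar r) \<omega> = k"
  shows "procedure_output n k p \<omega> = of_nat (C_count n k q p K)"
proof -
  interpret Z: residues_prime r "Zring r"
    by unfold_locales (use assms in auto)
  have r2: "r > 2" using assms(1-3) prime_gt_1_nat[OF assms(4)] by (cases n; cases k) auto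
  have carrier: "carrier (Zring r) = {0..int r - 1}" by (simp add: residue_ring_def)
  interpret cyclotomy "Zring r" n k K "int q mod int r" \<omega>
  proof (intro cyclotomy.intro cyclotomy_axioms.intro)
    show "finite (carrier (Zring r))" by (simp add: carrier)
    show "card (carrier (Zring r)) = n * k + 1" unfolding assms(3)[symmetric] by (simp add: carrier)
    show "\<ominus>\<^bsub>Zring r\<^esub> \<one>\<^bsub>Zring r\<^esub> \<noteq> \<one>\<^bsub>Zring r\<^esub>" using Z.one_eq_neg_one r2 by fastforce
    show "int q mod int r \<in> Units (Zring r)"
    proof -
      have "coprime (int q) (int r)"
        using prime_imp_coprime_nat[OF assms(4,9)] by (simp add: coprime_commute)
      then show ?thesis using r2 by (intro Z.mod_in_res_units) simp_all
    qed
    show "\<omega> \<in> Units (Zring r)" using assms(13) by (simp only: units_of_carrier)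
  qed (fact Z.field_axioms assms)+
  let ?t = "\<lambda>c. card {x \<in> points. cell x = c}"
  have S: "S_val r \<omega> = S" by (simp add: S_val_def S_def Let_def)
  have S_mset: "S_mset r k \<omega> = S_multiset" by (simp add: S_mset_def S_multiset_def S)
  have r: "n * k + 1 = r" using assms(3) by simp
  have a: "a_coeff n k \<omega> \<tau> = of_nat (card {c \<in> {..<n} \<times> {..<n}. ?t c = \<tau>})" if "\<tau> \<le> k" for \<tau>
    using step3_all_cells[OF that] unfolding a_coeff_def M_mset_def r S_mset .
  have a_star: "a_star_coeff n k \<omega> \<tau> = of_nat (card {c \<in> {idx (\<ominus>\<^bsub>Zring r\<^esub> \<one>\<^bsub>Zring r\<^esub>)} \<times> {..<n}. ?t c = \<tau>})"
    if "\<tau> \<le> k" for \<tau>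
    using step3_special_cells[OF that]
    unfolding a_star_coeff_def M_star_mset_def special_coset_def Let_def r S_mset .
  have "cyclotomic_number r K q i j = ?t (i, j)" if "i < n" "j < n" for i j
    using card_cell[OF that] by (simp add: cyclotomic_number_def cyc_coset_def Let_def)
  moreover have "cyc_delta n k i = (if i = idx (\<ominus>\<^bsub>Zring r\<^esub> \<one>\<^bsub>Zring r\<^esub>) then 1 else 0)" if "i < n" for i
    using idx_minus_one[OF that] by (simp add: cyc_delta_def)
  ultimately have C: "C_count n k q p K = card {(i, j). i < n \<and> j < n \<and>
      \<not> [int (?t (i, j)) - int k * int (if i = idx (\<ominus>\<^bsub>Zring r\<^esub> \<one>\<^bsub>Zring r\<^esub>) then 1 else 0) = 0] (mod int p)}"
    unfolding C_count_def r by (intro arg_cong[where f = card] Collect_cong) auto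
  show ?thesis
    unfolding procedure_output_def C
    by (rule count_nonvanishing_cells)
      (use a a_star card_cell_le idx_less minus_one_unit in auto)
qed

end
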